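(* There is a constant $C>0$ such that for every integer $n\ge 1$, $$\left\lfloor\tfrac{1}{3}n^2\right\rfloor\leq E_3(n)\leq \tfrac{3}{8}n^2+C\,n^{3/2}.$$
   Context: A set of points in $\mathbf{R}^d$ is convexly independent if it is the vertex set of its convex hull, i.e. no point of it lies in the convex hull of the others. $E_d(n)$: for a finite set $P\subset\mathbf{R}^d$, let $E(P)$ be the maximum number of (unordered) pairs of distinct points of $P$ such that the midpoints of these pairs are convexly independent (distinct pairs selected having distinct midpoints); $E_d(n)=\max\{E(P): P\subset\mathbf{R}^d, |P|=n\}$. *)

theory Defs
  imports "HOL-Analysis.Analysis"
begin

definition convexly_independent :: "'a::real_vector set \<Rightarrow> bool" where
  "convexly_independent S \<longleftrightarrow> (\<forall>x\<in>S. x \<notin> convex hull (S - {x}))"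

definition point_pairs :: "'a set \<Rightarrow> 'a set set" where
  "point_pairs P = {e. e \<subseteq> P \<and> card e = 2}"

(* Only meant for two-element sets; the sum makes it independent of an order on the pair. *)
definition pair_midpoint :: "'a::real_vector set \<Rightarrow> 'a" where
  "pair_midpoint e = (\<Sum>x\<in>e. x) /\<^sub>R 2"

lemma pair_midpoint_eq_midpoint: "x \<noteq> y \<Longrightarrow> pair_midpoint {x, y} = midpoint x y"
  by (simp add: pair_midpoint_def midpoint_def)

definition midpoint_selection :: "'a::real_vector set \<Rightarrow> 'a set set \<Rightarrow> bool" where
  "midpoint_selection P F \<longleftrightarrow>
     F \<subseteq> point_pairs P \<and> inj_on pair_midpoint F \<and> convexly_independent (pair_midpoint ` F)"

definition max_midpoints :: "'a::real_vector set \<Rightarrow> nat" where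
  "max_midpoints P = Max (card ` {F. midpoint_selection P F})"

(* The ambient space, hence its dimension, is given by the type argument. *)
definition E_max :: "'a::euclidean_space itself \<Rightarrow> nat \<Rightarrow> nat" where
  "E_max _ n = Max {max_midpoints P | P :: 'a set. finite P \<and> card P = n}"

text \<open>Both maxima range over finite nonempty sets, so they are genuine maxima.\<close>

lemma finite_point_pairs: "finite P \<Longrightarrow> finite (point_pairs P)"
  by (simp add: point_pairs_def)

lemma finite_midpoint_selections: "finite P \<Longrightarrow> finite {F. midpoint_selection P F}"
  by (rule finite_subset[of _ "Pow (point_pairs P)"])
     (auto simp: midpoint_selection_def finite_point_pairs)

lemma midpoint_selection_empty: "midpoint_selection P {}"
  by (simp add: midpoint_selection_def convexly_independent_def)

lemma max_midpoints_le:
  assumes "finite P"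
  shows "max_midpoints P \<le> card P choose 2"
proof -
  have "card F \<le> card P choose 2" if "midpoint_selection P F" for F
    using that card_mono[OF finite_point_pairs[OF assms], of F] n_subsets[OF assms, of 2]
    by (simp add: midpoint_selection_def point_pairs_def)
  then show ?thesis
    unfolding max_midpoints_def
    using finite_midpoint_selections[OF assms] midpoint_selection_empty[of P]
    by (subst Max_le_iff) auto
qed

lemma finite_max_midpoints_values:
  "finite {max_midpoints P | P :: 'a::euclidean_space set. finite P \<and> card P = n}"
  by (rule finite_subset[of _ "{.. n choose 2}"]) (auto intro: max_midpoints_le)

lemma max_midpoints_values_nonempty:
  "{max_midpoints P | P :: 'a::euclidean_space set. finite P \<and> card P = n} \<noteq> {}"
proof -
  have "infinite (UNIV :: 'a set)"
    using not_bounded_UNIV finite_imp_bounded by blast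
  then obtain P :: "'a set" where "finite P" "card P = n"
    using infinite_arbitrarily_large by blast
  then show ?thesis by blast
qed

end

theory Submission
  imports Defs
begin

text \<open>Upper bound: view the selected pairs as the edges of a graph. Convex independence excludes a
  Radon partition of type (2,3) of a 5-clique, so one of its vertices lies in the hull of the other
  four; and a 4-clique has at most one common neighbour in its hull. Hence there are at most as many
  5-cliques as 4-cliques. But if all degrees are at least \<open>(3 n + 6) / 4\<close>, each 4-clique lies in six
  5-cliques, which gives more 5-cliques than 4-cliques. So there is always a vertex of smaller
  degree, and deleting such vertices one by one bounds the number of edges by \<open>(3 n\<^sup>2 + 13 n) / 8\<close>.

  Lower bound: three arcs such that a functional can be made to peak at a prescribed point on each
  of two of them while staying small on the third. All pairs of points from different arcs can then
  be selected.\<close>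

section \<open>Cliques of selected pairs\<close>

definition cliques :: "'a set set \<Rightarrow> 'a set \<Rightarrow> nat \<Rightarrow> 'a set set" where
  "cliques F P k = {S. S \<subseteq> P \<and> card S = k \<and> point_pairs S \<subseteq> F}"

definition nbrs :: "'a set set \<Rightarrow> 'a set \<Rightarrow> 'a \<Rightarrow> 'a set" where
  "nbrs F P x = {y \<in> P. y \<noteq> x \<and> {x, y} \<in> F}"

lemma point_pairs_iff: "e \<in> point_pairs P \<longleftrightarrow> (\<exists>x\<in>P. \<exists>y\<in>P. x \<noteq> y \<and> e = {x, y})"
  by (auto simp: point_pairs_def card_2_iff)

lemma point_pairs_mono: "P \<subseteq> Q \<Longrightarrow> point_pairs P \<subseteq> point_pairs Q"
  by (auto simp: point_pairs_def)

lemma point_pairs_subset_iff: "point_pairs S \<subseteq> F \<longleftrightarrow> (\<forall>x\<in>S. \<forall>y\<in>S. x \<noteq> y \<longrightarrow> {x, y} \<in> F)"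
  by (auto simp: subset_iff point_pairs_iff)

lemma finite_cliques: "finite P \<Longrightarrow> finite (cliques F P k)"
  by (rule finite_subset[of _ "Pow P"]) (auto simp: cliques_def)

section \<open>Extending cliques by common neighbours; 4-cliques against 5-cliques\<close>

lemma insert_in_cliques:
  assumes "finite P" "S \<in> cliques F P k" "y \<in> P" "\<forall>x\<in>S. y \<in> nbrs F P x"
  shows "y \<notin> S" "insert y S \<in> cliques F P (Suc k)"
proof -
  show "y \<notin> S"
    using assms(4) by (auto simp: nbrs_def)
  moreover have "finite S"
    using assms(1,2) by (auto simp: cliques_def intro: finite_subset)
  ultimately show "insert y S \<in> cliques F P (Suc k)"
    using assms(2-4) unfolding cliques_def point_pairs_subset_iff nbrs_def
    by (auto simp: insert_commute)
qed

text \<open>Each vertex of \<open>S\<close> rules out at most \<open>card P - d\<close> points of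
  \<open>P\<close>. The terms are arranged so that no truncated subtraction on \<open>nat\<close>
  occurs.\<close>

lemma card_common_nbrs:
  assumes "finite P" "finite S" and deg: "\<And>x. x \<in> S \<Longrightarrow> d \<le> card (nbrs F P x)"
  shows "card S * d + card P \<le> card {y \<in> P. \<forall>x\<in>S. y \<in> nbrs F P x} + card S * card P"
  using assms(2) deg
proof (induction S)
  case empty
  then show ?case by simp
next
  case (insert a S)
  let ?A = "{y \<in> P. \<forall>x\<in>S. y \<in> nbrs F P x}"
  let ?B = "nbrs F P a"
  have eq: "{y \<in> P. \<forall>x\<in>insert a S. y \<in> nbrs F P x} = ?A \<inter> ?B"
    by auto
  have sub: "?A \<union> ?B \<subseteq> P" by (auto simp: nbrs_def)
  have fin: "finite ?A" "finite ?B"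
    using \<open>finite P\<close> by (auto simp: nbrs_def)
  have "card ?A + card ?B = card (?A \<union> ?B) + card (?A \<inter> ?B)"
    by (rule card_Un_Int[OF fin])
  moreover have "card (?A \<union> ?B) \<le> card P"
    using sub \<open>finite P\<close> card_mono by blast
  moreover have "d \<le> card ?B" using insert.prems by auto
  moreover have "card S * d + card P \<le> card ?A + card S * card P"
    using insert.IH insert.prems by auto
  ultimately show ?case
    unfolding eq using insert.hyps by simp
qed

text \<open>Double counting of 5-cliques with a marked vertex: removing the marked vertex leaves a
  4-clique, each 4-clique arises at least six times, each 5-clique carries five marks. So
  \<open>6 * c4 \<le> 5 * c5\<close>, which is strict for the counts once a 4-clique exists.\<close>

lemma card_cliques_less:
  assumes fin: "finite P" and ne: "P \<noteq> {}"
    and deg: "\<And>x. x \<in> P \<Longrightarrow> 3 * card P + 6 \<le> 4 * card (nbrs F P x)"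
  shows "card (cliques F P 4) < card (cliques F P 5)"
proof -
  \<comment> \<open>The ceiling of \<open>(3 * card P + 6) / 4\<close>, the least integer degree
    that the hypothesis allows.\<close>
  define d where "d = (3 * card P + 9) div 4"
  define N where "N S = {y \<in> P. \<forall>x\<in>S. y \<in> nbrs F P x}" for S
  have n: "card P > 0" using fin ne by (simp add: card_gt_0_iff)
  have d: "3 * card P + 6 \<le> 4 * d" "\<And>x. x \<in> P \<Longrightarrow> d \<le> card (nbrs F P x)"
    using deg unfolding d_def by (presburger, fastforce)
  \<comment> \<open>For \<open>k < 4\<close> this bound is positive, so cliques grow greedily from
    the empty one up to size 4; for \<open>k = 4\<close> it yields the six common
    neighbours.\<close>
  have N: "(4 - k) * card P + 6 * k \<le> 4 * card (N S)"
    if "S \<in> cliques F P k" "k \<le> 4" for S k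
  proof -
    have S: "card S = k" "S \<subseteq> P" "finite S"
      using that fin by (auto simp: cliques_def intro: finite_subset)
    have "k * d + card P \<le> card (N S) + k * card P"
      unfolding N_def S(1)[symmetric]
      by (rule card_common_nbrs) (use fin S d in auto)
    moreover have "k * (3 * card P + 6) \<le> k * (4 * d)"
      using d(1) by (rule mult_le_mono2)
    moreover have "4 = (4 - k) + k" using that by simp
    then have "4 * card P = (4 - k) * card P + k * card P"
      by (metis add_mult_distrib)
    ultimately show ?thesis by (simp add: algebra_simps)
  qed
  have ext: "y \<notin> S \<and> insert y S \<in> cliques F P (Suc k)" if "S \<in> cliques F P k" "y \<in> N S" for S y k
    using insert_in_cliques[OF fin that(1)] that(2) by (auto simp: N_def)
  have ex: "cliques F P k \<noteq> {}" if "k \<le> 4" for k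
    using that
  proof (induction k)
    case 0
    have "{} \<in> cliques F P 0" by (auto simp: cliques_def point_pairs_def)
    then show ?case by blast
  next
    case (Suc k)
    then obtain S where S: "S \<in> cliques F P k" by auto
    have "(4 - k) * card P > 0" using n Suc.prems by simp
    then have "card (N S) > 0" using N[OF S] Suc.prems by linarith
    then obtain y where "y \<in> N S" by (metis card_gt_0_iff ex_in_conv)
    then show ?case using ext[OF S] by blast
  qed
  have finC: "finite (cliques F P k)" for k using finite_cliques[OF fin] .
  let ?A = "Sigma (cliques F P 4) N" and ?B = "Sigma (cliques F P 5) (\<lambda>T. T)"
  have "card ?A \<le> card ?B"
  \<comment> \<open>Keeping \<open>y\<close> in the image makes the map injective: \<open>S\<close>
    is recovered by deleting the mark.\<close>
  proof (rule card_inj_on_le[of "\<lambda>(S, y). (insert y S, y)"])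
    show "inj_on (\<lambda>(S, y). (insert y S, y)) ?A"
    proof (rule inj_onI)
      fix a b assume "a \<in> ?A" "b \<in> ?A" "(case a of (S, y) \<Rightarrow> (insert y S, y)) = (case b of (S, y) \<Rightarrow> (insert y S, y))"
      then obtain S T y where "a = (S, y)" "b = (T, y)" "insert y S = insert y T" "y \<notin> S" "y \<notin> T"
        using ext by (cases a; cases b) auto
      then show "a = b" by (metis insert_ident)
    qed
    show "(\<lambda>(S, y). (insert y S, y)) ` ?A \<subseteq> ?B"
      using ext[of _ 4] by auto
    show "finite ?B"
      using finC fin by (intro finite_SigmaI) (auto simp: cliques_def intro: finite_subset)
  qed
  moreover have "card ?B = 5 * card (cliques F P 5)"
  proof -
    have "card ?B = (\<Sum>T\<in>cliques F P 5. card T)"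
      using finC fin by (intro card_SigmaI) (auto simp: cliques_def intro: finite_subset)
    also have "\<dots> = (\<Sum>T\<in>cliques F P 5. 5)"
      by (rule sum.cong) (auto simp: cliques_def)
    finally show ?thesis by simp
  qed
  moreover have "6 * card (cliques F P 4) \<le> card ?A"
  proof -
    have "(\<Sum>S\<in>cliques F P 4. 6) \<le> (\<Sum>S\<in>cliques F P 4. card (N S))"
      using N[of _ 4] by (intro sum_mono) auto
    also have "\<dots> = card ?A"
      using finC fin by (intro card_SigmaI[symmetric]) (auto simp: N_def)
    finally show ?thesis by simp
  qed
  moreover have "card (cliques F P 4) > 0"
    using ex[of 4] finC by (simp add: card_gt_0_iff)
  ultimately show ?thesis by linarith
qed

section \<open>Edge bound by deleting vertices of small degree\<close>

lemma card_point_pairs_delete: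
  assumes "finite P" "v \<in> P"
  shows "card (F \<inter> point_pairs P) = card (F \<inter> point_pairs (P - {v})) + card (nbrs F P v)"
proof -
  have eq: "F \<inter> point_pairs P = (F \<inter> point_pairs (P - {v})) \<union> (\<lambda>y. {v, y}) ` nbrs F P v"
  proof (intro equalityI subsetI)
    fix e assume e: "e \<in> F \<inter> point_pairs P"
    show "e \<in> (F \<inter> point_pairs (P - {v})) \<union> (\<lambda>y. {v, y}) ` nbrs F P v"
    proof (cases "v \<in> e")
      case True
      with e obtain y where "y \<in> P" "y \<noteq> v" "e = {v, y}"
        by (auto simp: point_pairs_iff)
      then show ?thesis using e by (auto simp: nbrs_def)
    next
      case False
      then show ?thesis using e by (auto simp: point_pairs_def)
    qed
  next
    fix e assume "e \<in> (F \<inter> point_pairs (P - {v})) \<union> (\<lambda>y. {v, y}) ` nbrs F P v"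
    then show "e \<in> F \<inter> point_pairs P"
      using assms(2) by (auto simp: point_pairs_def nbrs_def)
  qed
  have "card (F \<inter> point_pairs P)
      = card (F \<inter> point_pairs (P - {v})) + card ((\<lambda>y. {v, y}) ` nbrs F P v)"
    unfolding eq using assms(1)
    by (intro card_Un_disjoint) (auto simp: nbrs_def point_pairs_def)
  also have "card ((\<lambda>y. {v, y}) ` nbrs F P v) = card (nbrs F P v)"
    by (rule card_image) (auto simp: inj_on_def doubleton_eq_iff)
  finally show ?thesis .
qed

text \<open>The clique hypothesis is made for all subsets so that it survives deletions. The
  constant 13 is tuned to the induction: for \<open>m = card P\<close> the bound drops by
  \<open>6 * m + 10\<close> when a vertex goes, and a degree \<open>d\<close> with
  \<open>4 * d < 3 * m + 6\<close> satisfies \<open>8 * d \<le> 6 * m + 10\<close>.\<close>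

lemma card_edges_le_if_few_5_cliques:
  assumes "finite P" and "\<And>Q. Q \<subseteq> P \<Longrightarrow> card (cliques F Q 5) \<le> card (cliques F Q 4)"
  shows "8 * card (F \<inter> point_pairs P) \<le> 3 * (card P)\<^sup>2 + 13 * card P"
  using assms
proof (induction P rule: finite_psubset_induct)
  case (psubset P)
  show ?case
  proof (cases "P = {}")
    case True
    then show ?thesis by (auto simp: point_pairs_iff Int_def)
  next
    case False
    have "\<not> card (cliques F P 4) < card (cliques F P 5)"
      using psubset.prems[of P] by simp
    then obtain v where v: "v \<in> P" "4 * card (nbrs F P v) < 3 * card P + 6"
      using card_cliques_less[OF psubset.hyps(1) False, of F] by (meson not_le)
    have "8 * card (F \<inter> point_pairs (P - {v})) \<le> 3 * (card (P - {v}))\<^sup>2 + 13 * card (P - {v})"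
      using v(1) psubset.prems by (intro psubset.IH) auto
    moreover have "card P = Suc (card (P - {v}))"
      using psubset.hyps(1) v(1) by (rule card.remove)
    ultimately show ?thesis
      using v(2) card_point_pairs_delete[OF psubset.hyps(1) v(1), of F]
      by (simp add: power2_eq_square algebra_simps)
  qed
qed

section \<open>The upper bound\<close>

text \<open>Since distinct selected pairs have distinct midpoints, leaving out a pair really leaves
  out its midpoint. Convex independence is used in this form below.\<close>

lemma midpoint_selection_notin_hull:
  assumes "midpoint_selection P F" "e \<in> F" "T \<subseteq> F - {e}"
  shows "pair_midpoint e \<notin> convex hull (pair_midpoint ` T)"
proof -
  have "pair_midpoint ` T \<subseteq> pair_midpoint ` F - {pair_midpoint e}"
    using assms by (auto simp: midpoint_selection_def inj_on_def)
  then have "convex hull (pair_midpoint ` T) \<subseteq> convex hull (pair_midpoint ` F - {pair_midpoint e})"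
    by (rule hull_mono)
  then show ?thesis
    using assms by (auto simp: midpoint_selection_def convexly_independent_def)
qed

text \<open>The homothety with centre \<open>b\<close> and ratio 1/2 commutes with taking convex
  hulls.\<close>

lemma midpoint_in_hull:
  assumes "z \<in> convex hull S" "b \<notin> S"
  shows "midpoint b z \<in> convex hull (pair_midpoint ` (\<lambda>y. {b, y}) ` S)"
proof -
  have mid: "midpoint b y = (1/2) *\<^sub>R b + (1/2) *\<^sub>R y" for y
    by (simp add: midpoint_def scaleR_add_right)
  have "pair_midpoint ` (\<lambda>y. {b, y}) ` S = (\<lambda>y. (1/2) *\<^sub>R b + (1/2) *\<^sub>R y) ` S"
    unfolding image_image mid[symmetric]
    using assms(2) by (intro image_cong) (auto intro!: pair_midpoint_eq_midpoint)
  then show ?thesis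
    using assms(1) by (simp add: convex_hull_affinity mid)
qed

text \<open>By exchange, two points of the hull of \<open>K\<close> would put one of them into the hull of the other
  and \<open>K - {b}\<close>, and averaging with \<open>b\<close> carries this over to midpoints.\<close>

lemma unique_inner_extension:
  fixes P :: "'a::euclidean_space set"
  assumes sel: "midpoint_selection P F"
    and v: "v \<notin> K" "point_pairs (insert v K) \<subseteq> F" "v \<in> convex hull K"
    and w: "w \<notin> K" "point_pairs (insert w K) \<subseteq> F" "w \<in> convex hull K"
  shows "v = w"
proof (rule ccontr)
  assume "v \<noteq> w"
  obtain b where b: "b \<in> K" "v \<in> convex hull (insert w (K - {b}))"
    using in_convex_hull_exchange[OF w(3) v(3)] .
  let ?S = "insert w (K - {b})"
  have "midpoint b v \<in> convex hull (pair_midpoint ` (\<lambda>y. {b, y}) ` ?S)"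
    using b w(1) by (intro midpoint_in_hull) auto
  moreover have "b \<noteq> v" using b v by auto
  moreover have "{b, v} \<in> F" "(\<lambda>y. {b, y}) ` ?S \<subseteq> F"
    using b(1) \<open>b \<noteq> v\<close> v w unfolding point_pairs_subset_iff by auto
  moreover have "{b, v} \<notin> (\<lambda>y. {b, y}) ` ?S"
    using v(1) \<open>v \<noteq> w\<close> by (auto simp: doubleton_eq_iff)
  ultimately show False
    using midpoint_selection_notin_hull[OF sel, of "{b, v}" "(\<lambda>y. {b, y}) ` ?S"]
    by (auto simp: pair_midpoint_eq_midpoint)
qed

text \<open>If \<open>z = t p + (1 - t) q\<close> lies in the hull of \<open>S\<close>, then
  \<open>p + q = (1 - t) (p + z) + t (q + z)\<close>.\<close>

lemma segment_hull_disjoint: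
  fixes P :: "'a::euclidean_space set"
  assumes sel: "midpoint_selection P F"
    and "p \<noteq> q" "p \<notin> S" "q \<notin> S" and clique: "point_pairs (insert p (insert q S)) \<subseteq> F"
  shows "convex hull {p, q} \<inter> convex hull S = {}"
proof (rule ccontr)
  assume "convex hull {p, q} \<inter> convex hull S \<noteq> {}"
  then obtain z where z: "z \<in> convex hull {p, q}" "z \<in> convex hull S" by auto
  then obtain t u where t: "z = t *\<^sub>R p + u *\<^sub>R q" "0 \<le> t" "0 \<le> u" "t + u = 1"
    by (auto simp: convex_hull_2)
  let ?T = "(\<lambda>y. {p, y}) ` S \<union> (\<lambda>y. {q, y}) ` S"
  let ?H = "convex hull (pair_midpoint ` ?T)"
  have p: "midpoint p z \<in> ?H"
    using midpoint_in_hull[OF z(2) assms(3)] by (rule rev_subsetD) (rule hull_mono, auto)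
  have q: "midpoint q z \<in> ?H"
    using midpoint_in_hull[OF z(2) assms(4)] by (rule rev_subsetD) (rule hull_mono, auto)
  have "u *\<^sub>R midpoint p z + t *\<^sub>R midpoint q z \<in> ?H"
    using convexD[OF convex_convex_hull p q, of u t] t by auto
  moreover have "u *\<^sub>R midpoint p z + t *\<^sub>R midpoint q z = midpoint p q"
  proof -
    have "u *\<^sub>R midpoint p z + t *\<^sub>R midpoint q z
        = (1/2) *\<^sub>R (u *\<^sub>R p + t *\<^sub>R q + (t + u) *\<^sub>R z)"
      by (simp add: midpoint_def algebra_simps)
    also have "u *\<^sub>R p + t *\<^sub>R q + (t + u) *\<^sub>R z = (t + u) *\<^sub>R p + (t + u) *\<^sub>R q"
    proof -
      have "(t + u) *\<^sub>R z = t *\<^sub>R p + u *\<^sub>R q"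
        using t(1,4) by simp
      then show ?thesis by (simp add: algebra_simps)
    qed
    finally show ?thesis by (simp add: t(4) midpoint_def)
  qed
  ultimately have "pair_midpoint {p, q} \<in> ?H"
    using assms(2) by (simp add: pair_midpoint_eq_midpoint)
  moreover have "{p, q} \<in> F" "?T \<subseteq> F - {{p, q}}"
    using assms(2-4) clique unfolding point_pairs_subset_iff
    by (auto simp: doubleton_eq_iff)
  ultimately show False
    using midpoint_selection_notin_hull[OF sel] by blast
qed

text \<open>Five points in dimension 3 are affinely dependent, so Radon's theorem applies. The
  smaller part has at most two points; a segment is excluded by
  \<open>segment_hull_disjoint\<close>, and a single point is the inner vertex. In the upper bound,
  dimension 3 enters only here.\<close>

lemma five_clique_inner_vertex:
  fixes P :: "(real ^ 3) set"
  assumes sel: "midpoint_selection P F" and T: "card T = 5" "point_pairs T \<subseteq> F"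
  obtains v where "v \<in> T" "v \<in> convex hull (T - {v})"
proof -
  have finT: "finite T" using T(1) by (metis card.infinite zero_neq_numeral)
  then have "affine_dependent T"
    using T(1) by (intro affine_dependent_biggerset) auto
  then obtain M N where MN: "M \<subseteq> T" "N \<subseteq> T" "M \<inter> N = {}" "convex hull M \<inter> convex hull N \<noteq> {}"
    by (rule Radon)
  have inner: "\<exists>v\<in>T. v \<in> convex hull (T - {v})"
    if A: "A \<subseteq> T" "B \<subseteq> T" "A \<inter> B = {}" "convex hull A \<inter> convex hull B \<noteq> {}" "card A \<le> 2" for A B
  proof -
    have "finite A" "A \<noteq> {}" using A finT by (auto intro: finite_subset)
    then have "card A \<noteq> 0" by simp
    with A(5) consider "card A = 1" | "card A = 2" by linarith
    then show ?thesis
    proof cases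
      case 1
      then obtain v where v: "A = {v}" by (metis card_1_singletonE)
      have "convex hull B \<subseteq> convex hull (T - {v})"
        using A v by (intro hull_mono) auto
      then show ?thesis using A v by auto
    next
      case 2
      then obtain p q where pq: "A = {p, q}" "p \<noteq> q" by (auto simp: card_2_iff)
      have "point_pairs (insert p (insert q B)) \<subseteq> F"
        using T(2) point_pairs_mono[of "insert p (insert q B)" T] A pq by auto
      then have "convex hull {p, q} \<inter> convex hull B = {}"
        using A(3) pq by (intro segment_hull_disjoint[OF sel]) auto
      then show ?thesis using A(4) pq by simp
    qed
  qed
  have "card M + card N \<le> 5"
    using MN finT T(1) by (metis card_Un_disjoint card_mono finite_subset le_sup_iff)
  then consider "card M \<le> 2" | "card N \<le> 2" by linarith
  then show thesis
    using inner[of M N] inner[of N M] MN that by cases (auto simp: Int_commute)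
qed

text \<open>Dropping an inner vertex, chosen arbitrarily, sends 5-cliques to 4-cliques. If two
  5-cliques have the same image, both dropped vertices lie in the hull of that 4-clique, and
  \<open>unique_inner_extension\<close> identifies them.\<close>

lemma card_5_cliques_le:
  fixes P :: "(real ^ 3) set"
  assumes sel: "midpoint_selection P F" and "finite Q"
  shows "card (cliques F Q 5) \<le> card (cliques F Q 4)"
proof -
  define c where "c T = (SOME v. v \<in> T \<and> v \<in> convex hull (T - {v}))" for T :: "(real ^ 3) set"
  have c: "c T \<in> T \<and> c T \<in> convex hull (T - {c T})" if "T \<in> cliques F Q 5" for T
  proof -
    have "card T = 5" "point_pairs T \<subseteq> F" using that by (auto simp: cliques_def)
    then obtain v where "v \<in> T \<and> v \<in> convex hull (T - {v})"
      using five_clique_inner_vertex[OF sel] by metis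
    then show ?thesis unfolding c_def by (rule someI)
  qed
  show ?thesis
  proof (rule card_inj_on_le[of "\<lambda>T. T - {c T}"])
    show "inj_on (\<lambda>T. T - {c T}) (cliques F Q 5)"
    proof (rule inj_onI)
      fix S T assume S: "S \<in> cliques F Q 5" and T: "T \<in> cliques F Q 5"
        and eq: "S - {c S} = T - {c T}"
      have ins: "insert (c S) (S - {c S}) = S" "insert (c T) (S - {c S}) = T"
        using c[OF S] c[OF T] eq by auto
      have "c S = c T"
      proof (rule unique_inner_extension[OF sel])
        show "c S \<in> convex hull (S - {c S})" "c T \<in> convex hull (S - {c S})"
          using c[OF S] c[OF T] eq by auto
        show "point_pairs (insert (c S) (S - {c S})) \<subseteq> F" "point_pairs (insert (c T) (S - {c S})) \<subseteq> F"
          unfolding ins using S T by (auto simp: cliques_def)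
        show "c S \<notin> S - {c S}" "c T \<notin> S - {c S}"
          using eq by auto
      qed
      then show "S = T" using ins by simp
    qed
    show "(\<lambda>T. T - {c T}) ` cliques F Q 5 \<subseteq> cliques F Q 4"
    proof (rule image_subsetI)
      fix T assume T: "T \<in> cliques F Q 5"
      have "card (T - {c T}) = 4" using T c[OF T] by (simp add: cliques_def)
      then show "T - {c T} \<in> cliques F Q 4"
        using T point_pairs_mono[of "T - {c T}" T] by (auto simp: cliques_def)
    qed
    show "finite (cliques F Q 4)" using assms(2) by (rule finite_cliques)
  qed
qed

section \<open>From selections to \<open>E_max\<close>\<close>

lemma card_midpoint_selection_le:
  fixes P :: "(real ^ 3) set"
  assumes "midpoint_selection P F" "finite P"
  shows "8 * card F \<le> 3 * (card P)\<^sup>2 + 13 * card P"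
proof -
  have "F \<inter> point_pairs P = F"
    using assms(1) by (auto simp: midpoint_selection_def)
  moreover have "8 * card (F \<inter> point_pairs P) \<le> 3 * (card P)\<^sup>2 + 13 * card P"
    using assms by (intro card_edges_le_if_few_5_cliques card_5_cliques_le) (auto intro: finite_subset)
  ultimately show ?thesis by simp
qed

lemma max_midpoints_attained:
  assumes "finite P"
  obtains F where "midpoint_selection P F" "card F = max_midpoints P"
proof -
  have "Max (card ` {F. midpoint_selection P F}) \<in> card ` {F. midpoint_selection P F}"
    using finite_midpoint_selections[OF assms] midpoint_selection_empty[of P]
    by (intro Max_in) auto
  then show thesis using that by (auto simp: max_midpoints_def)
qed

lemma E_max_3_upper: "8 * E_max TYPE(real ^ 3) n \<le> 3 * n\<^sup>2 + 13 * n"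
proof -
  have "E_max TYPE(real ^ 3) n \<in> {max_midpoints P | P :: (real ^ 3) set. finite P \<and> card P = n}"
    unfolding E_max_def by (intro Max_in finite_max_midpoints_values max_midpoints_values_nonempty)
  then obtain P :: "(real ^ 3) set"
    where P: "finite P" "card P = n" "E_max TYPE(real ^ 3) n = max_midpoints P" by auto
  obtain F where "midpoint_selection P F" "card F = max_midpoints P"
    using max_midpoints_attained[OF P(1)] .
  then show ?thesis using card_midpoint_selection_le[of P F] P by simp
qed

section \<open>The lower bound\<close>

text \<open>A functional with its strict maximum at one pair puts all other midpoints into an open
  halfspace that misses this one. As the comparison is between pairs, it also separates their
  midpoints.\<close>

lemma midpoint_selectionI:
  fixes P :: "'a::real_inner set"
  assumes "F \<subseteq> point_pairs P"
    and "\<And>e. e \<in> F \<Longrightarrow> \<exists>f. \<forall>e'\<in>F. e' \<noteq> e \<longrightarrow> f \<bullet> pair_midpoint e' < f \<bullet> pair_midpoint e"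
  shows "midpoint_selection P F"
  unfolding midpoint_selection_def convexly_independent_def
proof (intro conjI ballI)
  show "inj_on pair_midpoint F"
    using assms(2) by (intro inj_onI) (metis less_irrefl)
  fix x assume "x \<in> pair_midpoint ` F"
  then obtain e where e: "e \<in> F" "x = pair_midpoint e" by auto
  obtain f where f: "\<forall>e'\<in>F. e' \<noteq> e \<longrightarrow> f \<bullet> pair_midpoint e' < f \<bullet> x"
    using assms(2)[OF e(1)] e(2) by auto
  have "convex hull (pair_midpoint ` F - {x}) \<subseteq> {y. f \<bullet> y < f \<bullet> x}"
    using f e(2) by (intro hull_minimal convex_halfspace_lt) auto
  then show "x \<notin> convex hull (pair_midpoint ` F - {x})" by auto
qed (fact assms(1))

text \<open>Three curves; a functional with coordinate sum 1 and \<open>k\<close>-th coordinate \<open>1 / s\<close> is, on the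
  \<open>k\<close>-th curve, maximal exactly at parameter \<open>s\<close>. Two coordinates can thus be prescribed, and for
  \<open>s < 1/2\<close> the third is then negative.\<close>

definition curve :: "3 \<Rightarrow> real \<Rightarrow> real ^ 3" where
  "curve k s = (1 - s\<^sup>2) *\<^sub>R axis k 1 + (2 * s) *\<^sub>R 1"

definition support :: "3 \<Rightarrow> real \<Rightarrow> 3 \<Rightarrow> real \<Rightarrow> real ^ 3" where
  "support a s b t = (\<chi> k. if k = a then 1 / s else if k = b then 1 / t else 1 - 1 / s - 1 / t)"

text \<open>The coordinates of the functional sum to 1, whence the term \<open>2 * r\<close>. For a
  positive \<open>k\<close>-th coordinate \<open>c\<close> this is a concave parabola in
  \<open>r\<close> with vertex \<open>1 / c\<close>, which explains the entries \<open>1 / s\<close>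
  and \<open>1 / t\<close>.\<close>

lemma inner_support_curve:
  assumes "a \<noteq> b"
  shows "support a s b t \<bullet> curve k r = (1 - r\<^sup>2) * (support a s b t $ k) + 2 * r"
proof -
  have "a \<in> {1, 2, 3}" "b \<in> {1, 2, 3}" using exhaust_3 by auto
  then have "support a s b t \<bullet> 1 = 1"
    using assms by (auto simp: support_def inner_vec_def sum_3)
  then show ?thesis
    by (simp add: curve_def inner_add_right inner_axis)
qed

lemma inner_support_curve_values:
  assumes "a \<noteq> b" and s: "0 < s" "s < 1/2" and t: "0 < t" "t < 1/2" and r: "0 < r" "r < 1/2"
  shows "support a s b t \<bullet> curve a r = 1 / s + s - (r - s)\<^sup>2 / s"
    and "support a s b t \<bullet> curve b r = 1 / t + t - (r - t)\<^sup>2 / t"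
    and "k \<noteq> a \<Longrightarrow> k \<noteq> b \<Longrightarrow> support a s b t \<bullet> curve k r < 0"
proof -
  show "support a s b t \<bullet> curve a r = 1 / s + s - (r - s)\<^sup>2 / s"
    using s unfolding inner_support_curve[OF assms(1)]
    by (simp add: support_def field_simps power2_eq_square)
  show "support a s b t \<bullet> curve b r = 1 / t + t - (r - t)\<^sup>2 / t"
    using t assms(1) unfolding inner_support_curve[OF assms(1)]
    by (simp add: support_def field_simps power2_eq_square)
  assume k: "k \<noteq> a" "k \<noteq> b"
  \<comment> \<open>The bound 1/2 on the parameters acts here: the third coordinate is below -3 and
    \<open>1 - r\<^sup>2\<close> exceeds 3/4, so the product outweighs
    \<open>2 * r < 1\<close>.\<close>
  have "1 / s > 2" "1 / t > 2" using s t by (simp_all add: field_simps)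
  then have g: "1 - 1 / s - 1 / t < -3" by linarith
  have "r * r < 1/2 * (1/2)" using r by (intro mult_strict_mono) auto
  then have r2: "1 - r\<^sup>2 > 3/4" by (simp add: power2_eq_square)
  have "(1 - r\<^sup>2) * (1 - 1 / s - 1 / t) \<le> (1 - r\<^sup>2) * (-3)"
    using g r2 by (intro mult_left_mono) auto
  also have "\<dots> < -2 * r" using r2 r by simp
  finally show "support a s b t \<bullet> curve k r < 0"
    using k unfolding inner_support_curve[OF assms(1)] by (simp add: support_def)
qed

text \<open>Two points on different curves either use exactly the curves \<open>a\<close> and
  \<open>b\<close>, each with its own peak, or one of them lies on the third curve and contributes a
  negative value. Two points on one curve must be excluded, since near the higher peak they could
  win.\<close>

lemma support_curve_pair:
  assumes ab: "a \<noteq> b" and s: "0 < s" "s < 1/2" and t: "0 < t" "t < 1/2"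
    and kl: "k \<noteq> l" and r: "0 < r" "r < 1/2" and q: "0 < q" "q < 1/2"
    and ne: "{(k, r), (l, q)} \<noteq> {(a, s), (b, t)}"
  shows "support a s b t \<bullet> (curve k r + curve l q) < support a s b t \<bullet> (curve a s + curve b t)"
proof -
  let ?f = "\<lambda>k r. support a s b t \<bullet> curve k r"
  have quot: "0 \<le> (x - y)\<^sup>2 / y" "(x - y)\<^sup>2 / y = 0 \<longleftrightarrow> x = y" if "0 < y" for x y :: real
    using that by auto
  have a: "?f a r \<le> ?f a s" "?f a r = ?f a s \<longleftrightarrow> r = s" if "0 < r" "r < 1/2" for r
    using inner_support_curve_values(1)[OF ab s t that] inner_support_curve_values(1)[OF ab s t s]
      quot[OF s(1), of r] by auto
  have b: "?f b r \<le> ?f b t" "?f b r = ?f b t \<longleftrightarrow> r = t" if "0 < r" "r < 1/2" for r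
    using inner_support_curve_values(2)[OF ab s t that] inner_support_curve_values(2)[OF ab s t t]
      quot[OF t(1), of r] by auto
  have pos: "?f a s > 0" "?f b t > 0"
    using inner_support_curve_values(1)[OF ab s t s] inner_support_curve_values(2)[OF ab s t t] s t
    by (auto intro: add_pos_pos)
  have neg: "?f k r < 0" if "0 < r" "r < 1/2" "k \<noteq> a" "k \<noteq> b" for k r
    using inner_support_curve_values(3)[OF ab s t that] .
  consider "k = a" "l = b" | "k = b" "l = a" | "k \<noteq> a" "k \<noteq> b" | "l \<noteq> a" "l \<noteq> b"
    using kl by auto
  then have "?f k r + ?f l q < ?f a s + ?f b t"
  proof cases
    case 1
    then have "r \<noteq> s \<or> q \<noteq> t" using ne by auto
    then have "?f a r < ?f a s \<or> ?f b q < ?f b t"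
      using a[OF r] b[OF q] by linarith
    then show ?thesis using 1 a(1)[OF r] b(1)[OF q] by auto
  next
    case 2
    then have "r \<noteq> t \<or> q \<noteq> s" using ne by (auto simp: insert_commute)
    then have "?f b r < ?f b t \<or> ?f a q < ?f a s"
      using a[OF q] b[OF r] by linarith
    then show ?thesis using 2 a(1)[OF q] b(1)[OF r] by auto
  next
    case 3
    \<comment> \<open>Both peaks are positive, so the larger one alone is below their sum.\<close>
    have "?f l q \<le> max (?f a s) (?f b t)"
      using a(1)[OF q] b(1)[OF q] neg[OF q, of l] pos by (cases "l = a"; cases "l = b") auto
    then show ?thesis using neg[OF r 3] pos by linarith
  next
    case 4
    have "?f k r \<le> max (?f a s) (?f b t)"
      using a(1)[OF r] b(1)[OF r] neg[OF r, of k] pos by (cases "k = a"; cases "k = b") auto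
    then show ?thesis using neg[OF q 4] pos by linarith
  qed
  then show ?thesis by (simp add: inner_add_right)
qed

section \<open>Counting index pairs in different residue classes modulo 3\<close>

lemma card_mod_3_eq: "card {i. i < j \<and> i mod 3 = j mod 3} = j div 3" for j :: nat
proof -
  have "bij_betw (\<lambda>m. 3 * m + j mod 3) {..<j div 3} {i. i < j \<and> i mod 3 = j mod 3}"
  proof (rule bij_betw_byWitness[where f' = "\<lambda>i. i div 3"])
    show "(\<lambda>m. 3 * m + j mod 3) ` {..<j div 3} \<subseteq> {i. i < j \<and> i mod 3 = j mod 3}"
      by auto
    show "(\<lambda>i. i div 3) ` {i. i < j \<and> i mod 3 = j mod 3} \<subseteq> {..<j div 3}"
    proof clarsimp
      fix i assume "i < j" "i mod 3 = j mod 3"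
      then show "i div 3 < j div 3"
        using mult_div_mod_eq[of 3 i] mult_div_mod_eq[of 3 j] by linarith
    qed
    show "\<forall>i\<in>{i. i < j \<and> i mod 3 = j mod 3}. 3 * (i div 3) + j mod 3 = i"
      by clarsimp (metis mult_div_mod_eq)
  qed auto
  from bij_betw_same_card[OF this] show ?thesis by simp
qed

text \<open>This is the edge count of the balanced complete tripartite graph. Pairs are grouped by
  the larger index \<open>j\<close>: of the \<open>j\<close> smaller indices, \<open>j div 3\<close>
  share its residue.\<close>

lemma card_tripartite_pairs:
  "card {(i, j). i < j \<and> j < n \<and> i mod 3 \<noteq> j mod 3} = n\<^sup>2 div 3" for n :: nat
proof -
  have "{(i, j). i < j \<and> j < n \<and> i mod 3 \<noteq> j mod 3}
      = prod.swap ` (SIGMA j:{..<n}. {i. i < j \<and> i mod 3 \<noteq> j mod 3})"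
    by (auto simp: image_iff)
  then have "card {(i, j). i < j \<and> j < n \<and> i mod 3 \<noteq> j mod 3}
      = (\<Sum>j<n. card {i. i < j \<and> i mod 3 \<noteq> j mod 3})"
    by (simp add: card_image)
  also have "\<dots> = (\<Sum>j<n. j - j div 3)"
  proof (rule sum.cong)
    fix j :: nat
    have "{i. i < j \<and> i mod 3 \<noteq> j mod 3} = {..<j} - {i. i < j \<and> i mod 3 = j mod 3}" by auto
    then show "card {i. i < j \<and> i mod 3 \<noteq> j mod 3} = j - j div 3"
      by (simp add: card_Diff_subset card_mod_3_eq subset_iff)
  qed simp
  also have "\<dots> = n\<^sup>2 div 3"
  proof (induction n)
    case (Suc n)
    define k where "k = n div 3"
    \<comment> \<open>Naming the square leaves linear goals once each square is written as
      \<open>3 * x\<close> or \<open>3 * x + 1\<close>.\<close>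
    define m where "m = k\<^sup>2"
    have div3: "3 * x div 3 = x" "(3 * x + 1) div 3 = x" for x :: nat by simp_all
    have "n = 3 * k \<or> n = 3 * k + 1 \<or> n = 3 * k + 2" unfolding k_def by presburger
    then have "n\<^sup>2 div 3 + (n - n div 3) = (Suc n)\<^sup>2 div 3"
    proof (elim disjE)
      assume n: "n = 3 * k"
      have sq: "n\<^sup>2 = 3 * (3 * m)" "(Suc n)\<^sup>2 = 3 * (3 * m + 2 * k) + 1"
        unfolding n m_def by (simp_all add: power2_eq_square algebra_simps)
      show ?thesis unfolding sq div3 using n by simp
    next
      assume n: "n = 3 * k + 1"
      have sq: "n\<^sup>2 = 3 * (3 * m + 2 * k) + 1" "(Suc n)\<^sup>2 = 3 * (3 * m + 4 * k + 1) + 1"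
        unfolding n m_def by (simp_all add: power2_eq_square algebra_simps)
      show ?thesis unfolding sq div3 using n by simp
    next
      assume n: "n = 3 * k + 2"
      have sq: "n\<^sup>2 = 3 * (3 * m + 4 * k + 1) + 1" "(Suc n)\<^sup>2 = 3 * (3 * m + 6 * k + 3)"
        unfolding n m_def by (simp_all add: power2_eq_square algebra_simps)
      show ?thesis unfolding sq div3 using n by simp
    qed
    then show ?case using Suc by simp
  qed simp
  finally show ?thesis .
qed

text \<open>Points are dealt cyclically to the three curves, and all pairs from different curves are
  selected.\<close>

lemma E_max_3_lower: "n\<^sup>2 div 3 \<le> E_max TYPE(real ^ 3) n"
proof -
  obtain h :: "nat \<Rightarrow> 3" where h: "inj_on h {0..<3}"
    using ex_bij_betw_nat_finite[of "UNIV :: 3 set"] by (auto simp: bij_betw_def)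
  define c where "c i = h (i mod 3)" for i
  have c: "c i = c j \<longleftrightarrow> i mod 3 = j mod 3" for i j
    using h by (auto simp: c_def inj_on_def)
  \<comment> \<open>Distinct parameters, strictly between 0 and 1/2 for
    \<open>i < n\<close>.\<close>
  define s where "s i = (real i + 1) / (2 * real n + 2)" for i
  have s: "0 < s i" "s i < 1/2" if "i < n" for i
    using that by (auto simp: s_def field_simps)
  have s_inj: "s i = s j \<longleftrightarrow> i = j" for i j
    by (auto simp: s_def field_simps)
  define p where "p i = curve (c i) (s i)" for i
  define D where "D = {(i, j). i < j \<and> j < n \<and> i mod 3 \<noteq> j mod 3}"
  define pair where "pair = (\<lambda>(i, j). {p i, p j})"
  \<comment> \<open>The order \<open>i < j\<close> in \<open>D\<close> ensures that different index
    pairs give different unordered pairs of curve points.\<close>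
  have exposed: "support (c i) (s i) (c j) (s j) \<bullet> (p k + p l)
      < support (c i) (s i) (c j) (s j) \<bullet> (p i + p j)"
    if "(i, j) \<in> D" "(k, l) \<in> D" "(k, l) \<noteq> (i, j)" for i j k l
    unfolding p_def using that s[of i] s[of j] s[of k] s[of l]
    by (intro support_curve_pair) (auto simp: D_def c doubleton_eq_iff s_inj)
  have p_inj: "inj_on p {..<n}"
  proof (rule inj_onI)
    fix i j assume ij: "i \<in> {..<n}" "j \<in> {..<n}" and eq: "p i = p j"
    have p_nth: "p i $ k = (if k = c i then 1 - (s i)\<^sup>2 else 0) + 2 * s i" for i k
      by (simp add: p_def curve_def axis_def)
    \<comment> \<open>In a coordinate belonging to neither curve, both points show just twice their
      parameter.\<close>
    obtain k where k: "k \<noteq> c i" "k \<noteq> c j"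
    proof -
      have "card {c i, c j} < card (UNIV :: 3 set)"
        using card_insert_le_m1[of 2 "{c j}" "c i"] by simp
      then have "{c i, c j} \<noteq> UNIV" by (metis less_irrefl)
      then show thesis using that by blast
    qed
    then have "s i = s j" using p_nth[of i k] p_nth[of j k] eq by simp
    then show "i = j" by (simp add: s_inj)
  qed
  have pair: "pair e \<in> point_pairs (p ` {..<n})" "pair_midpoint (pair e) = (p i + p j) /\<^sub>R 2"
    if "e = (i, j)" "(i, j) \<in> D" for e i j
  proof -
    have "i < n" "j < n" "i \<noteq> j" using that by (auto simp: D_def)
    then have "p i \<noteq> p j" using p_inj by (auto simp: inj_on_def)
    then show "pair e \<in> point_pairs (p ` {..<n})" "pair_midpoint (pair e) = (p i + p j) /\<^sub>R 2"
      using that \<open>i < n\<close> \<open>j < n\<close> by (auto simp: pair_def point_pairs_iff pair_midpoint_def)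
  qed
  have "midpoint_selection (p ` {..<n}) (pair ` D)"
  proof (rule midpoint_selectionI)
    show "pair ` D \<subseteq> point_pairs (p ` {..<n})"
      using pair(1) by auto
    fix e assume "e \<in> pair ` D"
    then obtain i j where ij: "(i, j) \<in> D" "e = pair (i, j)" by auto
    let ?f = "support (c i) (s i) (c j) (s j)"
    have "?f \<bullet> pair_midpoint e' < ?f \<bullet> pair_midpoint e" if e': "e' \<in> pair ` D" "e' \<noteq> e" for e'
    proof -
      obtain k l where kl: "(k, l) \<in> D" "e' = pair (k, l)" using e'(1) by auto
      then have "(k, l) \<noteq> (i, j)" using e'(2) ij by auto
      from exposed[OF ij(1) kl(1) this] show ?thesis
        unfolding ij(2) kl(2) pair(2)[OF refl ij(1)] pair(2)[OF refl kl(1)] by simp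
    qed
    then show "\<exists>f. \<forall>e'\<in>pair ` D. e' \<noteq> e \<longrightarrow> f \<bullet> pair_midpoint e' < f \<bullet> pair_midpoint e"
      by blast
  qed
  moreover have "inj_on pair D"
  proof (rule inj_onI, clarify)
    fix i j k l assume D: "(i, j) \<in> D" "(k, l) \<in> D" and eq: "pair (i, j) = pair (k, l)"
    have "i < j" "k < l" "i < n" "j < n" "k < n" "l < n" using D by (auto simp: D_def)
    then show "i = k \<and> j = l"
      using eq inj_on_eq_iff[OF p_inj] by (auto simp: pair_def doubleton_eq_iff)
  qed
  then have "card (pair ` D) = n\<^sup>2 div 3"
    using card_tripartite_pairs[of n] by (simp add: card_image D_def)
  ultimately have "n\<^sup>2 div 3 \<le> max_midpoints (p ` {..<n})"
    unfolding max_midpoints_def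
    by (intro Max_ge finite_imageI finite_midpoint_selections) (auto simp: image_iff)
  also have "\<dots> \<le> E_max TYPE(real ^ 3) n"
    unfolding E_max_def using p_inj
    by (intro Max_ge finite_max_midpoints_values) (auto simp: card_image)
  finally show ?thesis .
qed

theorem theorem6:
  shows "\<exists>C::real. C > 0 \<and> (\<forall>n::nat. n \<ge> 1 \<longrightarrow>
           \<lfloor>1 / 3 * (real n)\<^sup>2\<rfloor> \<le> int (E_max TYPE(real ^ 3) n) \<and>
           real (E_max TYPE(real ^ 3) n) \<le> 3 / 8 * (real n)\<^sup>2 + C * real n powr (3 / 2))"
\<comment> \<open>The witness is the linear coefficient of
  \<open>(3 * n\<^sup>2 + 13 * n) / 8\<close>; the linear term is then weakened to the power 3/2,
  using \<open>n \<ge> 1\<close>.\<close>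
proof (intro exI[of _ "13/8"] conjI allI impI)
  fix n :: nat assume n: "n \<ge> 1"
  have "\<lfloor>1 / 3 * (real n)\<^sup>2\<rfloor> = int (n\<^sup>2 div 3)"
    using floor_divide_of_nat_eq[of "n\<^sup>2" 3, where ?'a = real] by simp
  then show "\<lfloor>1 / 3 * (real n)\<^sup>2\<rfloor> \<le> int (E_max TYPE(real ^ 3) n)"
    using E_max_3_lower[of n] by linarith
  have "real n = real n powr 1" by simp
  also have "\<dots> \<le> real n powr (3 / 2)"
    using n by (intro powr_mono) auto
  finally have "real n \<le> real n powr (3 / 2)" .
  moreover have "real (8 * E_max TYPE(real ^ 3) n) \<le> real (3 * n\<^sup>2 + 13 * n)"
    using E_max_3_upper[of n] by (rule of_nat_mono)
  ultimately show "real (E_max TYPE(real ^ 3) n) \<le> 3 / 8 * (real n)\<^sup>2 + 13 / 8 * real n powr (3 / 2)"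
    by simp
qed simp

end
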